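(* Let $n\ge 2$, $d\ge 2$ and let $U\subset A_d$ be a base-point-free subspace of codimension $1$. Then the following hold: (i) if $d\ge 3$, then $\operatorname{codim} U^2\in\{0,1\}$; (ii) if $d=2$, then $\operatorname{codim} U^2\le 2$.
   Context: $A=\mathbb{C}[x_1,\dots,x_n]$ with its standard grading; $A_d$ is the $\mathbb{C}$-vector space of forms of degree $d$. For a linear subspace $U\subset A_d$, $U^2:=\operatorname{span}(pq : p,q\in U)\subset A_{2d}$. $\operatorname{codim} U$ is the codimension in $A_d$ and $\operatorname{codim} U^2$ is the codimension in $A_{2d}$. $U$ is called base-point-free if there is no point $\xi\in\mathbb{P}^{n-1}(\mathbb{C})$ with $f(\xi)=0$ for all $f\in U$. *)

theory Defs
  imports Complex_Main "HOL-Library.Poly_Mapping"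
begin

text \<open>
  The ring \<open>\<complex>[x\<^sub>1, \<dots>, x\<^sub>n]\<close> is the subring of those finitely supported coefficient functions
  on monomials that only involve the variables with index below \<open>n\<close> (so \<open>x\<^sub>i\<close> has index
  \<open>i - 1\<close>). A monomial is itself a finitely supported exponent function, and the multiplication
  of \<open>Poly_Mapping\<close> (convolution) is the multiplication of polynomials.
\<close>

type_synonym monom = "nat \<Rightarrow>\<^sub>0 nat"
type_synonym cpoly = "monom \<Rightarrow>\<^sub>0 complex"

definition monom_degree :: "monom \<Rightarrow> nat" where
  "monom_degree m = (\<Sum>i\<in>Poly_Mapping.keys m. Poly_Mapping.lookup m i)"

definition monoms :: "nat \<Rightarrow> nat \<Rightarrow> monom set" where
  "monoms n d = {m. Poly_Mapping.keys m \<subseteq> {..<n} \<and> monom_degree m = d}"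

text \<open>The space \<open>A\<^sub>d\<close> of forms of degree \<open>d\<close> in \<open>n\<close> variables, including the zero polynomial.\<close>

definition forms :: "nat \<Rightarrow> nat \<Rightarrow> cpoly set" where
  "forms n d = {p. Poly_Mapping.keys p \<subseteq> monoms n d}"

definition eval_cpoly :: "(nat \<Rightarrow> complex) \<Rightarrow> cpoly \<Rightarrow> complex" where
  "eval_cpoly \<xi> p =
     (\<Sum>m\<in>Poly_Mapping.keys p. Poly_Mapping.lookup p m *
        (\<Prod>i\<in>Poly_Mapping.keys m. \<xi> i ^ Poly_Mapping.lookup m i))"

text \<open>Scalar multiplication, as multiplication by a constant polynomial.\<close>

definition cpoly_scale :: "complex \<Rightarrow> cpoly \<Rightarrow> cpoly" where
  "cpoly_scale c p = Poly_Mapping.single 0 c * p"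

global_interpretation cpoly: vector_space cpoly_scale
  by unfold_locales
    (simp_all add: cpoly_scale_def algebra_simps single_add mult_single
      flip: mult.assoc)

text \<open>
  Only used for \<open>U \<subseteq> forms n e\<close>; then both dimensions are finite and \<open>dim U \<le> dim (forms n e)\<close>
  (see \<open>forms_finite_dim\<close> and \<open>dim_le_dim_forms\<close> below), so that the subtraction of natural
  numbers is the codimension of \<open>U\<close> in \<open>forms n e\<close>.
\<close>

definition codim_forms :: "nat \<Rightarrow> nat \<Rightarrow> cpoly set \<Rightarrow> nat" where
  "codim_forms n e U = cpoly.dim (forms n e) - cpoly.dim U"

definition square_space :: "cpoly set \<Rightarrow> cpoly set" where
  "square_space U = cpoly.span {p * q | p q. p \<in> U \<and> q \<in> U}"

text \<open>
  Points of \<open>\<P>\<^sup>n\<^sup>-\<^sup>1(\<complex>)\<close> are represented by their homogeneous coordinate vectors, i.e. nonzero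
  vectors \<open>(\<xi> 0, \<dots>, \<xi> (n - 1))\<close>; the values \<open>\<xi> i\<close> for \<open>i \<ge> n\<close> do not matter for forms
  in \<open>n\<close> variables.
\<close>

definition base_point_free :: "nat \<Rightarrow> cpoly set \<Rightarrow> bool" where
  "base_point_free n U \<longleftrightarrow>
     \<not> (\<exists>\<xi>. (\<exists>i<n. \<xi> i \<noteq> 0) \<and> (\<forall>f\<in>U. eval_cpoly \<xi> f = 0))"


lemma lookup_cpoly_scale [simp]:
  "Poly_Mapping.lookup (cpoly_scale c p) m = c * Poly_Mapping.lookup p m"
  by (simp add: cpoly_scale_def Poly_Mapping.map.rep_eq when_def
      flip: mult_map_scale_conv_mult)

lemma subspace_forms: "cpoly.subspace (forms n d)"
proof (rule cpoly.subspaceI)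
  show "0 \<in> forms n d"
    by (simp add: forms_def)
  show "p + q \<in> forms n d" if "p \<in> forms n d" "q \<in> forms n d" for p q
    using that Poly_Mapping.keys_add[of p q] by (auto simp: forms_def)
  show "cpoly_scale c p \<in> forms n d" if "p \<in> forms n d" for c p
    using that by (auto simp: forms_def in_keys_iff)
qed

lemma finite_monoms: "finite (monoms n d)"
proof -
  let ?F = "{f. \<forall>i. (i \<in> {..<n} \<longrightarrow> f i \<in> {..d}) \<and> (i \<notin> {..<n} \<longrightarrow> f i = (0::nat))}"
  have "Poly_Mapping.lookup ` monoms n d \<subseteq> ?F"
  proof clarify
    fix m i assume m: "m \<in> monoms n d"
    have "Poly_Mapping.lookup m i \<le> d" if "i \<in> Poly_Mapping.keys m"
      using m that member_le_sum[of i "Poly_Mapping.keys m" "Poly_Mapping.lookup m"]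
      by (auto simp: monoms_def monom_degree_def)
    moreover have "Poly_Mapping.lookup m i = 0" if "i \<notin> Poly_Mapping.keys m"
      using that by (simp add: in_keys_iff)
    ultimately show "(i \<in> {..<n} \<longrightarrow> Poly_Mapping.lookup m i \<in> {..d}) \<and>
        (i \<notin> {..<n} \<longrightarrow> Poly_Mapping.lookup m i = 0)"
      using m by (cases "i \<in> Poly_Mapping.keys m") (auto simp: monoms_def)
  qed
  moreover have "finite ?F"
    by (rule finite_set_of_finite_funs) auto
  ultimately have "finite (Poly_Mapping.lookup ` monoms n d)"
    by (rule finite_subset)
  then show ?thesis
    by (rule finite_imageD) (auto intro: inj_onI poly_mapping_eqI)
qed

lemma cpoly_expansion:
  "p = (\<Sum>m\<in>Poly_Mapping.keys p. cpoly_scale (Poly_Mapping.lookup p m) (Poly_Mapping.single m 1))"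
proof (rule poly_mapping_eqI)
  fix k
  show "Poly_Mapping.lookup p k = Poly_Mapping.lookup
     (\<Sum>m\<in>Poly_Mapping.keys p. cpoly_scale (Poly_Mapping.lookup p m) (Poly_Mapping.single m 1)) k"
    by (simp add: lookup_sum lookup_single when_def in_keys_iff if_distrib
        sum.delta cong: if_cong)
qed

lemma forms_finite_dim:
  "forms n d \<subseteq> cpoly.span ((\<lambda>m. Poly_Mapping.single m 1) ` monoms n d)"
proof
  fix p assume "p \<in> forms n d"
  then show "p \<in> cpoly.span ((\<lambda>m. Poly_Mapping.single m 1) ` monoms n d)"
    by (subst cpoly_expansion, intro cpoly.span_sum cpoly.span_scale cpoly.span_base)
      (auto simp: forms_def)
qed

lemma dim_le_dim_forms:
  assumes "U \<subseteq> forms n d"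
  shows "cpoly.dim U \<le> cpoly.dim (forms n d)"
proof -
  obtain B where B: "B \<subseteq> forms n d" "cpoly.independent B" "forms n d \<subseteq> cpoly.span B"
    "card B = cpoly.dim (forms n d)"
    by (rule cpoly.basis_exists)
  have "finite B"
    using cpoly.independent_span_bound[OF finite_imageI[OF finite_monoms] B(2)]
      B(1) forms_finite_dim by blast
  then show ?thesis
    using cpoly.dim_le_card[of U B] assms B by auto
qed

lemma mult_in_forms:
  assumes "p \<in> forms n d" "q \<in> forms n e"
  shows "p * q \<in> forms n (d + e)"
proof -
  have "a + b \<in> monoms n (d + e)" if "a \<in> monoms n d" "b \<in> monoms n e" for a b
  proof -
    have deg: "monom_degree m = (\<Sum>i<n. Poly_Mapping.lookup m i)"
      if "Poly_Mapping.keys m \<subseteq> {..<n}" for m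
      unfolding monom_degree_def using that
      by (intro sum.mono_neutral_left) (auto simp: in_keys_iff)
    have "Poly_Mapping.keys (a + b) \<subseteq> {..<n}"
      using that Poly_Mapping.keys_add[of a b] by (auto simp: monoms_def)
    then show ?thesis
      using that by (auto simp: monoms_def deg lookup_add sum.distrib)
  qed
  then show ?thesis
    using assms Poly_Mapping.keys_mult[of p q] by (fastforce simp: forms_def)
qed

lemma square_space_subset_forms:
  assumes "U \<subseteq> forms n d"
  shows "square_space U \<subseteq> forms n (2 * d)"
  unfolding square_space_def mult_2
  using assms by (intro cpoly.span_minimal subspace_forms) (auto intro: mult_in_forms)

end

theory Submission
  imports Defs
begin

text \<open>
  Let \<open>U\<close> be the kernel of a functional \<open>\<phi>\<close> on \<open>A\<^sub>d\<close>. A functional \<open>L\<close> on \<open>A\<^sub>2\<^sub>d\<close> that vanishes on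
  \<open>U\<^sup>2\<close> satisfies \<open>L (p q) = \<phi> p \<psi> q + \<psi> p \<phi> q\<close> for a unique \<open>\<psi>\<close>, so the codimension of \<open>U\<^sup>2\<close> is the
  dimension of the space of these \<open>\<psi>\<close>. Write \<open>\<phi>\<^sub>k\<close> for the contraction \<open>u \<mapsto> \<phi> (x\<^sub>k u)\<close>. If all \<open>\<phi>\<^sub>k\<close> were
  proportional, \<open>\<phi>\<close> would be a multiple of a point evaluation and \<open>U\<close> would have a base point; so
  \<open>\<phi>\<^sub>i\<close> and \<open>\<phi>\<^sub>j\<close> are independent for some \<open>i, j\<close>. Since \<open>L\<close> only sees products,
  \<open>\<phi>\<^sub>k \<and> \<psi>\<^sub>l = \<phi>\<^sub>l \<and> \<psi>\<^sub>k\<close>, and Cartan's lemma gives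
  \<open>\<psi>\<^sub>i = p \<phi>\<^sub>i + q \<phi>\<^sub>j\<close> and \<open>\<psi>\<^sub>j = r \<phi>\<^sub>i - p \<phi>\<^sub>j\<close>. The numbers \<open>p, q, r\<close> determine \<open>\<psi>\<close>, and
  \<open>x\<^sub>i \<psi>\<^sub>j = x\<^sub>j \<psi>\<^sub>i\<close> says that \<open>\<phi>\<close> annihilates all multiples of the quadric \<open>r x\<^sub>i\<^sup>2 - 2 p x\<^sub>i x\<^sub>j - q x\<^sub>j\<^sup>2\<close>.
  If some \<open>\<phi>\<^sub>k\<close> is not in the span of \<open>\<phi>\<^sub>i, \<phi>\<^sub>j\<close>, then \<open>\<psi> = 0\<close>. Otherwise \<open>\<phi>\<close> is essentially binary, and
  the quadrics it annihilates form a space of dimension \<open>2\<close> if \<open>d = 2\<close> and at most \<open>1\<close> if \<open>d \<ge> 3\<close>.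
\<close>

section \<open>Linear functionals on polynomials\<close>

interpretation cpoly_functional:
  vector_space_pair cpoly_scale "(*) :: complex \<Rightarrow> complex \<Rightarrow> complex"
  by unfold_locales (auto simp: algebra_simps)

abbreviation functional :: "(cpoly \<Rightarrow> complex) \<Rightarrow> bool" where
  "functional \<equiv> Vector_Spaces.linear cpoly_scale (*)"

lemmas functional_simps =
  cpoly_functional.linear_add cpoly_functional.linear_diff
  cpoly_functional.linear_scale cpoly_functional.linear_0

lemma functionalI:
  assumes "\<And>p q. f (p + q) = f p + f q" "\<And>c p. f (cpoly_scale c p) = c * f p"
  shows "functional f"
  using assms by unfold_locales auto

lemma cpoly_scale_mult_left: "cpoly_scale c p * q = cpoly_scale c (p * q)"
  and cpoly_scale_mult_right: "p * cpoly_scale c q = cpoly_scale c (p * q)"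
  unfolding cpoly_scale_def by (simp only: mult.assoc, simp only: mult.left_commute)

lemma functional_mult_left:
  assumes "functional f"
  shows "functional (\<lambda>p. f (q * p))"
  by (intro functionalI) (simp_all add: functional_simps[OF assms] distrib_left cpoly_scale_mult_right)

lemma functional_mult_right:
  assumes "functional f"
  shows "functional (\<lambda>p. f (p * q))"
  by (intro functionalI) (simp_all add: functional_simps[OF assms] distrib_right cpoly_scale_mult_left)

lemma functional_combination:
  assumes "functional f" "functional g"
  shows "functional (\<lambda>p. a * f p - b * g p)"
  by (intro functionalI)
    (simp_all add: functional_simps[OF assms(1)] functional_simps[OF assms(2)]
      right_diff_distrib distrib_left mult.left_commute)

lemma separating_functional:
  assumes "b \<notin> cpoly.span S"
  obtains f where "functional f" "\<And>p. p \<in> cpoly.span S \<Longrightarrow> f p = 0" "f b = 1"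
proof -
  obtain B where B: "B \<subseteq> S" "cpoly.independent B" "S \<subseteq> cpoly.span B"
    by (rule cpoly.basis_exists)
  have span: "cpoly.span B = cpoly.span S"
    using B by (intro equalityI cpoly.span_mono cpoly.span_minimal) auto
  have b: "b \<notin> cpoly.span B" using assms span by simp
  have "cpoly.independent (insert b B)"
    using B(2) b by (simp add: cpoly.independent_insert)
  then obtain f where f: "functional f" "\<forall>x\<in>insert b B. f x = (if x = b then 1 else 0)"
    using cpoly_functional.linear_independent_extend
      [where B = "insert b B" and f = "\<lambda>x. if x = b then 1 else 0"] by blast
  have "f x = 0" if "x \<in> B" for x
    using f(2) that b cpoly.span_base[of x B] by auto
  then have "f p = 0" if "p \<in> cpoly.span S" for p
    using that span cpoly_functional.linear_eq_0_on_span[OF f(1)] by blast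
  then show ?thesis using that f by auto
qed

subsection \<open>Forms and variables\<close>

definition Var :: "nat \<Rightarrow> cpoly" where
  "Var i = Poly_Mapping.single (Poly_Mapping.single i 1) 1"

lemma Var_in_forms: "i < n \<Longrightarrow> Var i \<in> forms n 1"
  by (simp add: Var_def forms_def monoms_def monom_degree_def)

lemma Var_mult_in_forms: "i < n \<Longrightarrow> p \<in> forms n d \<Longrightarrow> Var i * p \<in> forms n (Suc d)"
  using mult_in_forms[OF Var_in_forms] by simp

lemma monom_degree_add_single:
  "monom_degree (m + Poly_Mapping.single i k) = monom_degree m + k"
proof -
  have eq: "monom_degree m' = (\<Sum>j\<in>insert i (Poly_Mapping.keys m). Poly_Mapping.lookup m' j)"
    if "Poly_Mapping.keys m' \<subseteq> insert i (Poly_Mapping.keys m)" for m'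
    unfolding monom_degree_def using that
    by (intro sum.mono_neutral_left) (auto simp: in_keys_iff)
  have "Poly_Mapping.keys (m + Poly_Mapping.single i k) \<subseteq> insert i (Poly_Mapping.keys m)"
    using Poly_Mapping.keys_add[of m "Poly_Mapping.single i k"] by (auto split: if_splits)
  then show ?thesis
    by (subst (1 2) eq) (auto simp: lookup_add sum.distrib lookup_single when_def)
qed

lemma forms_0_eq: "p \<in> forms n 0 \<Longrightarrow> p = cpoly_scale (Poly_Mapping.lookup p 0) 1"
proof (rule poly_mapping_eqI)
  fix m assume p: "p \<in> forms n 0"
  have "m = 0" if "m \<in> Poly_Mapping.keys p"
  proof -
    have "monom_degree m = 0" using p that by (auto simp: forms_def monoms_def)
    then show ?thesis
      by (intro poly_mapping_eqI) (auto simp: monom_degree_def in_keys_iff)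
  qed
  then show "Poly_Mapping.lookup p m = Poly_Mapping.lookup (cpoly_scale (Poly_Mapping.lookup p 0) 1) m"
    by (cases "m = 0") (auto simp: in_keys_iff lookup_one)
qed

lemma one_in_forms: "1 \<in> forms n 0"
  by (simp add: forms_def monoms_def monom_degree_def flip: single_one)

text \<open>Every monomial of positive degree is a variable times a monomial of degree one less, and
  monomials span the forms. So a functional vanishes once all its contractions do.\<close>

lemma functional_zero_forms_Suc:
  assumes "functional f" "\<And>i p. i < n \<Longrightarrow> p \<in> forms n d \<Longrightarrow> f (Var i * p) = 0"
    and "p \<in> forms n (Suc d)"
  shows "f p = 0"
proof -
  have "f (Poly_Mapping.single m 1) = 0" if m: "m \<in> monoms n (Suc d)" for m
  proof -
    have "Poly_Mapping.keys m \<noteq> {}" using m by (auto simp: monoms_def monom_degree_def)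
    then obtain i where i: "i \<in> Poly_Mapping.keys m" by blast
    define m' where "m' = m - Poly_Mapping.single i 1"
    have m_eq: "m = m' + Poly_Mapping.single i 1"
      using i by (intro poly_mapping_eqI)
        (auto simp: m'_def lookup_add lookup_minus lookup_single when_def in_keys_iff)
    have "Poly_Mapping.keys m' \<subseteq> Poly_Mapping.keys m"
      by (auto simp: m'_def in_keys_iff lookup_minus)
    moreover have "monom_degree m' = d"
      using m monom_degree_add_single[of m' i 1] by (simp add: m_eq monoms_def)
    ultimately have "Poly_Mapping.single m' 1 \<in> forms n d"
      using m by (auto simp: forms_def monoms_def)
    moreover have "Poly_Mapping.single m 1 = Var i * Poly_Mapping.single m' 1"
      by (simp add: Var_def mult_single m_eq add.commute)
    moreover have "i < n" using i m by (auto simp: monoms_def)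
    ultimately show ?thesis using assms(2) by metis
  qed
  then show ?thesis
    using cpoly_functional.linear_eq_0_on_span[OF assms(1) _ subsetD[OF forms_finite_dim assms(3)]]
    by auto
qed

text \<open>Products of forms of degrees \<open>a\<close> and \<open>b\<close> span the forms of
  degree \<open>a + b\<close>: the variables of the first factor are absorbed into the functional
  one at a time.\<close>

lemma functional_zero_forms_add:
  assumes "functional f" "\<And>p q. p \<in> forms n a \<Longrightarrow> q \<in> forms n b \<Longrightarrow> f (p * q) = 0"
    and "r \<in> forms n (a + b)"
  shows "f r = 0"
  using assms
proof (induction a arbitrary: f r)
  case 0
  then show ?case using one_in_forms by fastforce
next
  case (Suc a)
  have "f (Var i * p) = 0" if "i < n" "p \<in> forms n (a + b)" for i p
  proof (rule Suc.IH[where f = "\<lambda>p. f (Var i * p)"])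
    show "functional (\<lambda>p. f (Var i * p))" by (rule functional_mult_left) (rule Suc.prems)
    show "f (Var i * (p * q)) = 0" if "p \<in> forms n a" "q \<in> forms n b" for p q
      using Suc.prems(2)[OF Var_mult_in_forms[OF \<open>i < n\<close> that(1)] that(2)]
      by (simp add: mult.assoc)
  qed fact
  then show ?case
    using functional_zero_forms_Suc[OF Suc.prems(1), of n "a + b" r] Suc.prems(3) by simp
qed

section \<open>Point evaluations and base points\<close>

lemma functional_eval_cpoly: "functional (eval_cpoly \<xi>)"
proof -
  define ev :: "monom \<Rightarrow> complex" where "ev m = (\<Prod>i\<in>Poly_Mapping.keys m. \<xi> i ^ Poly_Mapping.lookup m i)" for m
  have eq: "eval_cpoly \<xi> p = (\<Sum>m\<in>S. Poly_Mapping.lookup p m * ev m)"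
    if "finite S" "Poly_Mapping.keys p \<subseteq> S" for p :: cpoly and S
    unfolding eval_cpoly_def ev_def using that
    by (intro sum.mono_neutral_left) (auto simp: in_keys_iff)
  show ?thesis
  proof (rule functionalI)
    fix p q :: cpoly and c
    let ?S = "Poly_Mapping.keys p \<union> Poly_Mapping.keys q"
    show "eval_cpoly \<xi> (p + q) = eval_cpoly \<xi> p + eval_cpoly \<xi> q"
      using Poly_Mapping.keys_add[of p q]
      by (subst (1 2 3) eq[of ?S]) (auto simp: lookup_add algebra_simps sum.distrib)
    show "eval_cpoly \<xi> (cpoly_scale c p) = c * eval_cpoly \<xi> p"
    proof -
      have "Poly_Mapping.keys (cpoly_scale c p) \<subseteq> Poly_Mapping.keys p"
        by (auto simp: in_keys_iff)
      then have "eval_cpoly \<xi> (cpoly_scale c p) =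
          (\<Sum>m\<in>Poly_Mapping.keys p. Poly_Mapping.lookup (cpoly_scale c p) m * ev m)"
        by (intro eq) simp_all
      also have "\<dots> = c * (\<Sum>m\<in>Poly_Mapping.keys p. Poly_Mapping.lookup p m * ev m)"
        unfolding sum_distrib_left lookup_cpoly_scale mult.assoc ..
      also have "\<dots> = c * eval_cpoly \<xi> p"
        using eq[of "Poly_Mapping.keys p" p] by simp
      finally show ?thesis .
    qed
  qed
qed

lemma eval_cpoly_Var_mult: "eval_cpoly \<xi> (Var i * p) = \<xi> i * eval_cpoly \<xi> p"
proof -
  define ev where "ev m = (\<Prod>i\<in>Poly_Mapping.keys m. \<xi> i ^ Poly_Mapping.lookup m i)" for m
  have ev_eq: "ev m = (\<Prod>i\<in>S. \<xi> i ^ Poly_Mapping.lookup m i)"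
    if "finite S" "Poly_Mapping.keys m \<subseteq> S" for m S
    unfolding ev_def using that
    by (intro prod.mono_neutral_left) (auto simp: in_keys_iff)
  have eval_single: "eval_cpoly \<xi> (Poly_Mapping.single m c) = c * ev m" for m c
    by (simp add: eval_cpoly_def ev_def)
  have ev_add: "ev (Poly_Mapping.single i 1 + m) = \<xi> i * ev m" for m
  proof -
    let ?S = "insert i (Poly_Mapping.keys m)"
    have "Poly_Mapping.keys (Poly_Mapping.single i 1 + m) \<subseteq> ?S"
      using Poly_Mapping.keys_add[of "Poly_Mapping.single i 1" m] by auto
    then show ?thesis
      by (subst (1 2) ev_eq[of ?S])
        (auto simp: lookup_add power_add prod.distrib lookup_single when_def
           if_distrib[of "\<lambda>k. _ ^ k"] prod.delta cong: if_cong)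
  qed
  \<comment> \<open>Both sides are linear in \<open>p\<close>, so their difference need only be
    checked on monomials.\<close>
  let ?g = "\<lambda>p. 1 * eval_cpoly \<xi> (Var i * p) - \<xi> i * eval_cpoly \<xi> p"
  have g: "functional ?g"
    by (intro functional_combination functional_mult_left functional_eval_cpoly)
  have "p \<in> cpoly.span (range (\<lambda>m. Poly_Mapping.single m 1))"
    by (subst cpoly_expansion, intro cpoly.span_sum cpoly.span_scale cpoly.span_base) auto
  moreover have "?g (Poly_Mapping.single m 1) = 0" for m
    by (simp add: Var_def mult_single eval_single ev_add[simplified])
  ultimately have "?g p = 0"
    using cpoly_functional.linear_eq_0_on_span[OF g, of "range (\<lambda>m. Poly_Mapping.single m 1)" p]
    by blast
  then show ?thesis by simp
qed

text \<open>Under \<open>f\<close>, each factor \<open>Var i\<close> may be traded for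
  \<open>b i / b i0\<close> times \<open>Var i0\<close>. Trading all \<open>d\<close> factors turns
  \<open>p\<close> into its value at \<open>b\<close>, up to the powers of \<open>b i0\<close>; the
  formula is cleared of denominators.\<close>

lemma proportional_contractions_imp_evaluation:
  assumes f: "functional f" and i0: "i0 < n"
    and contr: "\<And>i p. i < n \<Longrightarrow> p \<in> forms n (d - 1) \<Longrightarrow> b i0 * f (Var i * p) = b i * f (Var i0 * p)"
    and p: "p \<in> forms n d"
  shows "b i0 ^ d * f p = eval_cpoly b p * f (Var i0 ^ d)"
proof -
  \<comment> \<open>The cofactor \<open>q\<close> keeps the total degree at \<open>d\<close> while
    the degree \<open>k\<close> of the part already traded varies in the induction.\<close>
  have *: "b i0 ^ k * f (p * q) = eval_cpoly b p * f (Var i0 ^ k * q)"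
    if "p \<in> forms n k" "q \<in> forms n l" "k + l = d" for p q k l
    using that
  proof (induction k arbitrary: l p q)
    case 0
    obtain c where p: "p = cpoly_scale c 1" using forms_0_eq[OF 0(1)] by blast
    have "eval_cpoly b 1 = 1"
      by (simp add: eval_cpoly_def flip: single_one)
    then show ?case
      by (simp add: p cpoly_scale_mult_left functional_simps[OF f] functional_simps[OF functional_eval_cpoly])
  next
    case (Suc k)
    have mult_rotate: "x * (y * z) = z * (y * x)" for x y z :: complex by simp
    let ?g = "\<lambda>p. b i0 ^ Suc k * f (p * q) - f (Var i0 ^ Suc k * q) * eval_cpoly b p"
    have "?g p = 0"
    proof (rule functional_zero_forms_Suc)
      show "functional ?g"
        by (intro functional_combination functional_mult_right f functional_eval_cpoly)
      show "p \<in> forms n (Suc k)" by fact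
      fix i t assume i: "i < n" and t: "t \<in> forms n k"
      have "Var i0 ^ k \<in> forms n k"
        by (induction k) (auto intro: Var_mult_in_forms i0 one_in_forms)
      then have in_forms: "Var i0 ^ k * q \<in> forms n (d - 1)"
        using mult_in_forms[of _ n k q l] Suc.prems by fastforce
      have "b i0 ^ Suc k * f (Var i * t * q) = b i0 * (b i0 ^ k * f (t * (Var i * q)))"
        by (simp only: power_Suc mult.assoc mult.left_commute[of t "Var i"])
      also have "\<dots> = eval_cpoly b t * (b i0 * f (Var i * (Var i0 ^ k * q)))"
        using Suc.IH[OF t Var_mult_in_forms[OF i Suc.prems(2)]] Suc.prems(3)
        by (simp add: mult.left_commute[of "Var i0 ^ k" "Var i"] mult.left_commute[of "eval_cpoly b t"])
      also have "\<dots> = eval_cpoly b t * (b i * f (Var i0 * (Var i0 ^ k * q)))"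
        using contr[OF i in_forms] by simp
      also have "\<dots> = f (Var i0 * (Var i0 ^ k * q)) * (b i * eval_cpoly b t)"
        by (rule mult_rotate)
      finally show "?g (Var i * t) = 0"
        by (simp only: eval_cpoly_Var_mult power_Suc mult.assoc right_minus_eq)
    qed
    then show ?case by (simp only: right_minus_eq mult.commute[of "eval_cpoly b p"])
  qed
  show ?thesis using *[OF p one_in_forms] by simp
qed

lemma nonproportional_contractions:
  assumes f: "functional f" and p0: "p0 \<in> forms n (Suc d)" "f p0 \<noteq> 0"
    and U: "U \<subseteq> forms n (Suc d)" "\<And>p. p \<in> U \<Longrightarrow> f p = 0" and bpf: "base_point_free n U"
  obtains i j u v where "i < n" "j < n" "u \<in> forms n d" "v \<in> forms n d"
    "f (Var i * u) * f (Var j * v) \<noteq> f (Var j * u) * f (Var i * v)"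
proof -
  obtain i0 u0 where i0: "i0 < n" "u0 \<in> forms n d" "f (Var i0 * u0) \<noteq> 0"
  proof (rule ccontr)
    assume "\<not> thesis"
    then have "f p0 = 0"
      using that by (intro functional_zero_forms_Suc[OF f _ p0(1)]) auto
    then show False using p0(2) by simp
  qed
  \<comment> \<open>The candidate base point: if all contractions are proportional, their ratios can
    be read off at \<open>u0\<close>, where the one with index \<open>i0\<close> is nonzero.\<close>
  define b where "b i = f (Var i * u0)" for i
  have "\<exists>i v. i < n \<and> v \<in> forms n d \<and> b i0 * f (Var i * v) \<noteq> b i * f (Var i0 * v)"
  proof (rule ccontr)
    assume "\<not> ?thesis"
    then have eval: "b i0 ^ Suc d * f p = eval_cpoly b p * f (Var i0 ^ Suc d)"
      if "p \<in> forms n (Suc d)" for p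
      using proportional_contractions_imp_evaluation[OF f i0(1) _ that, of b]
      by (auto simp: b_def)
    \<comment> \<open>Otherwise \<open>eval\<close> would give \<open>f p0 = 0\<close>. With this
      factor nonzero, \<open>f p = 0\<close> forces \<open>p\<close> to vanish at
      \<open>b\<close>.\<close>
    have "f (Var i0 ^ Suc d) \<noteq> 0" using eval[OF p0(1)] p0(2) i0 by (auto simp: b_def)
    then have "eval_cpoly b p = 0" if "p \<in> U" for p
      using eval[of p] U that by auto
    then show False using bpf i0 unfolding base_point_free_def by (metis b_def)
  qed
  then show ?thesis using that i0 unfolding b_def by blast
qed


subsection \<open>The functionals vanishing on the square\<close>

lemma linear_system_trivial:
  fixes a b c d x y :: complex
  assumes "a * d \<noteq> b * c" "a * x + b * y = 0" "c * x + d * y = 0"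
  shows "x = 0 \<and> y = 0"
proof -
  have "(a * d - b * c) * x = 0" "(a * d - b * c) * y = 0" using assms(2,3) by algebra+
  then show ?thesis using assms(1) by simp
qed

text \<open>The degree is \<open>d = e + 2\<close>, so contractions live in degree
  \<open>e + 1\<close>, where \<open>z1, z2\<close> are dual to
  \<open>\<phi>\<^sub>i, \<phi>\<^sub>j\<close>. The parameters \<open>p, q, r\<close> of the sketch
  are the values of \<open>\<psi>\<close> at \<open>Var i * z1\<close>, \<open>Var i * z2\<close>
  and \<open>Var j * z1\<close>.\<close>

locale independent_contractions =
  fixes n e :: nat and \<phi> :: "cpoly \<Rightarrow> complex" and i j :: nat and z1 z2 :: cpoly
  assumes functional_\<phi>: "functional \<phi>"
    and ij: "i < n" "j < n"
    and z: "z1 \<in> forms n (Suc e)" "z2 \<in> forms n (Suc e)"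
    and dual: "\<phi> (Var i * z1) = 1" "\<phi> (Var j * z1) = 0"
      "\<phi> (Var i * z2) = 0" "\<phi> (Var j * z2) = 1"
begin

lemmas \<phi>_simps = functional_simps[OF functional_\<phi>]

text \<open>Says that \<open>\<phi> \<otimes> \<psi> + \<psi> \<otimes> \<phi>\<close> takes equal values on \<open>(x\<^sub>k u, x\<^sub>l v)\<close> and \<open>(x\<^sub>l u, x\<^sub>k v)\<close>,
  as it does if it factors through the multiplication of forms.\<close>

definition hankel :: "(cpoly \<Rightarrow> complex) \<Rightarrow> bool" where
  "hankel \<psi> \<longleftrightarrow> functional \<psi> \<and>
     (\<forall>k<n. \<forall>l<n. \<forall>u\<in>forms n (Suc e). \<forall>v\<in>forms n (Suc e).
       \<phi> (Var k * u) * \<psi> (Var l * v) + \<psi> (Var k * u) * \<phi> (Var l * v) =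
       \<phi> (Var l * u) * \<psi> (Var k * v) + \<psi> (Var l * u) * \<phi> (Var k * v))"

lemma hankelD:
  assumes "hankel \<psi>" "k < n" "l < n" "u \<in> forms n (Suc e)" "v \<in> forms n (Suc e)"
  shows "\<phi> (Var k * u) * \<psi> (Var l * v) + \<psi> (Var k * u) * \<phi> (Var l * v) =
       \<phi> (Var l * u) * \<psi> (Var k * v) + \<psi> (Var l * u) * \<phi> (Var k * v)"
  using assms by (auto simp: hankel_def)

text \<open>An instance of Cartan's lemma.\<close>

lemma hankel_contractions:
  assumes \<psi>: "hankel \<psi>" and u: "u \<in> forms n (Suc e)"
  shows "\<psi> (Var i * u) = \<psi> (Var i * z1) * \<phi> (Var i * u) + \<psi> (Var i * z2) * \<phi> (Var j * u)"
    and "\<psi> (Var j * u) = \<psi> (Var j * z1) * \<phi> (Var i * u) - \<psi> (Var i * z1) * \<phi> (Var j * u)"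
proof -
  have "\<psi> (Var j * z2) = - \<psi> (Var i * z1)"
    using hankelD[OF \<psi> ij z] dual by (simp add: eq_neg_iff_add_eq_0)
  \<comment> \<open>Testing against \<open>v = z2\<close> isolates the first contraction, against
    \<open>v = z1\<close> the second.\<close>
  then show "\<psi> (Var i * u) = \<psi> (Var i * z1) * \<phi> (Var i * u) + \<psi> (Var i * z2) * \<phi> (Var j * u)"
    "\<psi> (Var j * u) = \<psi> (Var j * z1) * \<phi> (Var i * u) - \<psi> (Var i * z1) * \<phi> (Var j * u)"
    using hankelD[OF \<psi> ij u z(1)] hankelD[OF \<psi> ij u z(2)] dual
    by (simp_all add: algebra_simps)
qed

text \<open>The parameters determine \<open>\<psi>\<close>: if they vanish, so do the contractions
  by \<open>Var i\<close> and \<open>Var j\<close>. Comparing \<open>k\<close> with \<open>i\<close>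
  then makes \<open>\<psi>\<^sub>k\<close> a multiple of \<open>\<phi>\<^sub>i\<close>, and
  comparing \<open>k\<close> with \<open>j\<close> shows that the factor is zero.\<close>

lemma hankel_zero:
  assumes \<psi>: "hankel \<psi>"
    and zero: "\<psi> (Var i * z1) = 0" "\<psi> (Var i * z2) = 0" "\<psi> (Var j * z1) = 0"
    and p: "p \<in> forms n (Suc (Suc e))"
  shows "\<psi> p = 0"
proof (rule functional_zero_forms_Suc)
  show "functional \<psi>" using \<psi> by (simp add: hankel_def)
  show "p \<in> forms n (Suc (Suc e))" by fact
  fix k u assume k: "k < n" and u: "u \<in> forms n (Suc e)"
  have 0: "\<psi> (Var i * v) = 0" "\<psi> (Var j * v) = 0" if "v \<in> forms n (Suc e)" for v
    using hankel_contractions[OF \<psi> that] zero by simp_all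
  have "\<psi> (Var k * u) = \<phi> (Var i * u) * \<psi> (Var k * z1)"
    using hankelD[OF \<psi> ij(1) k u z(1)] 0 u z dual by simp
  moreover have "\<psi> (Var k * z1) = 0"
    using hankelD[OF \<psi> ij(2) k z(1) z(2)] 0 z dual by simp
  ultimately show "\<psi> (Var k * u) = 0" by simp
qed

text \<open>Both contraction formulas compute \<open>\<psi> (Var i * (Var j * s))\<close>; the
  relation equates the results.\<close>

lemma hankel_relation:
  assumes \<psi>: "hankel \<psi>" and s: "s \<in> forms n e"
  shows "\<psi> (Var j * z1) * \<phi> (Var i * (Var i * s)) - 2 * \<psi> (Var i * z1) * \<phi> (Var i * (Var j * s))
    - \<psi> (Var i * z2) * \<phi> (Var j * (Var j * s)) = 0"
  using hankel_contractions(1)[OF \<psi> Var_mult_in_forms[OF ij(2) s]]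
    hankel_contractions(2)[OF \<psi> Var_mult_in_forms[OF ij(1) s]]
  unfolding mult.left_commute[of "Var j" "Var i"] by algebra

text \<open>Every \<open>\<phi>\<^sub>k\<close> lies in the span of
  \<open>\<phi>\<^sub>i, \<phi>\<^sub>j\<close>; the coefficients are the only possible ones, by
  duality with \<open>z1, z2\<close>.\<close>

definition spanned :: bool where
  "spanned \<longleftrightarrow> (\<forall>k<n. \<forall>u\<in>forms n (Suc e).
     \<phi> (Var k * u) = \<phi> (Var k * z1) * \<phi> (Var i * u) + \<phi> (Var k * z2) * \<phi> (Var j * u))"

lemma hankel_zero_if_not_spanned:
  assumes \<psi>: "hankel \<psi>" and "\<not> spanned" and p: "p \<in> forms n (Suc (Suc e))"
  shows "\<psi> p = 0"
proof -
  obtain k u where k: "k < n" and u: "u \<in> forms n (Suc e)" and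
    ne: "\<phi> (Var k * u) \<noteq> \<phi> (Var k * z1) * \<phi> (Var i * u) + \<phi> (Var k * z2) * \<phi> (Var j * u)"
    using \<open>\<not> spanned\<close> by (auto simp: spanned_def)
  \<comment> \<open>The projection of \<open>u\<close> to the common kernel of
    \<open>\<phi>\<^sub>i\<close> and \<open>\<phi>\<^sub>j\<close>, on which
    \<open>\<phi>\<^sub>k\<close> still does not vanish.\<close>
  define z3 where "z3 = u - cpoly_scale (\<phi> (Var i * u)) z1 - cpoly_scale (\<phi> (Var j * u)) z2"
  have z3: "z3 \<in> forms n (Suc e)"
    unfolding z3_def
    by (intro cpoly.subspace_diff cpoly.subspace_scale subspace_forms u z)
  have dual3: "\<phi> (Var i * z3) = 0" "\<phi> (Var j * z3) = 0" "\<phi> (Var k * z3) \<noteq> 0"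
    using ne dual by (simp_all add: z3_def right_diff_distrib cpoly_scale_mult_right \<phi>_simps algebra_simps)
  have 3: "\<psi> (Var i * z3) = 0" "\<psi> (Var j * z3) = 0"
    using hankel_contractions[OF \<psi> z3] dual3 by simp_all
  have 2: "\<psi> (Var j * z2) = - \<psi> (Var i * z1)"
    using hankel_contractions(2)[OF \<psi> z(2)] dual by simp
  note h = hankelD[OF \<psi> _ k _ z3]
  \<comment> \<open>Comparing \<open>k\<close> with \<open>i\<close> and with \<open>j\<close>
    yields the same value with opposite signs, so the parameter \<open>p\<close> is zero.\<close>
  have e1: "\<psi> (Var k * z3) = \<psi> (Var i * z1) * (- \<phi> (Var k * z3))"
    using h[OF ij(1) z(1)] 3 dual dual3 by (simp add: add_eq_0_iff)
  have e2: "\<psi> (Var k * z3) = \<psi> (Var i * z1) * \<phi> (Var k * z3)"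
    using h[OF ij(2) z(2)] 2 3 dual dual3 by simp
  have "\<psi> (Var i * z1) = 0" using e1 e2 dual3(3) by simp
  moreover have "\<psi> (Var i * z2) = 0" using h[OF ij(1) z(2)] 3 dual dual3 by simp
  moreover have "\<psi> (Var j * z1) = 0" using h[OF ij(2) z(1)] 3 dual dual3 by simp
  ultimately show ?thesis using hankel_zero[OF \<psi> _ _ _ p] by simp
qed

text \<open>The hypotheses say that the contractions of
  \<open>a \<phi>\<^sub>i - b \<phi>\<^sub>j\<close> by \<open>Var i\<close> and
  \<open>Var j\<close> vanish. By \<open>spanned\<close> all its contractions vanish, hence so does
  the combination, and its values at \<open>z1, z2\<close> are \<open>a\<close> and
  \<open>- b\<close>.\<close>

lemma spanned_combination_zero:
  assumes spanned
    and zero: "\<And>s. s \<in> forms n e \<Longrightarrow> a * \<phi> (Var i * (Var i * s)) = b * \<phi> (Var i * (Var j * s))"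
      "\<And>s. s \<in> forms n e \<Longrightarrow> a * \<phi> (Var i * (Var j * s)) = b * \<phi> (Var j * (Var j * s))"
  shows "a = 0 \<and> b = 0"
proof -
  let ?g = "\<lambda>u. a * \<phi> (Var i * u) - b * \<phi> (Var j * u)"
  have g: "functional ?g"
    by (intro functional_combination functional_mult_left functional_\<phi>)
  have "?g (Var k * s) = 0" if k: "k < n" and s: "s \<in> forms n e" for k s
  proof -
    note sp = \<open>spanned\<close>[unfolded spanned_def, rule_format, OF k]
    have "?g (Var k * s) = a * \<phi> (Var k * (Var i * s)) - b * \<phi> (Var k * (Var j * s))"
      by (simp only: mult.left_commute[of _ "Var k"])
    also have "\<dots> = \<phi> (Var k * z1) * (a * \<phi> (Var i * (Var i * s)) - b * \<phi> (Var i * (Var j * s)))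
        + \<phi> (Var k * z2) * (a * \<phi> (Var i * (Var j * s)) - b * \<phi> (Var j * (Var j * s)))"
      using sp[OF Var_mult_in_forms[OF ij(1) s]] sp[OF Var_mult_in_forms[OF ij(2) s]]
      unfolding mult.left_commute[of "Var j" "Var i"] by algebra
    finally show ?thesis using zero[OF s] by simp
  qed
  then have "?g z1 = 0" "?g z2 = 0"
    using functional_zero_forms_Suc[OF g] z by blast+
  then show ?thesis using dual by simp
qed

text \<open>Provides one nontrivial linear relation among the three parameters, through
  \<open>hankel_relation\<close>.\<close>

lemma spanned_quadric_nonzero:
  assumes spanned
  obtains s where "s \<in> forms n e"
    "\<phi> (Var i * (Var i * s)) \<noteq> 0 \<or> \<phi> (Var i * (Var j * s)) \<noteq> 0 \<or> \<phi> (Var j * (Var j * s)) \<noteq> 0"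
  using spanned_combination_zero[OF assms, of 1 0] by fastforce

text \<open>Provides two independent relations among the parameters when \<open>d \<ge> 3\<close>.
  If all minors vanished, the triple of functionals \<open>A, B, C\<close> would be a scalar
  functional times a fixed triple \<open>\<alpha>, \<beta>, \<gamma>\<close>; both cases for the
  determinant \<open>\<alpha> \<gamma> - \<beta>\<^sup>2\<close> are contradictory.\<close>

lemma spanned_minor_nonzero:
  assumes spanned and e: "e = Suc e'"
  obtains s t where "s \<in> forms n e" "t \<in> forms n e"
    "\<phi> (Var i * (Var i * s)) * \<phi> (Var i * (Var j * t)) \<noteq> \<phi> (Var i * (Var j * s)) * \<phi> (Var i * (Var i * t)) \<or>
     \<phi> (Var i * (Var i * s)) * \<phi> (Var j * (Var j * t)) \<noteq> \<phi> (Var j * (Var j * s)) * \<phi> (Var i * (Var i * t)) \<or>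
     \<phi> (Var i * (Var j * s)) * \<phi> (Var j * (Var j * t)) \<noteq> \<phi> (Var j * (Var j * s)) * \<phi> (Var i * (Var j * t))"
proof (rule ccontr)
  assume neg: "\<not> thesis"
  note contra = that
  define A B C where "A s = \<phi> (Var i * (Var i * s))" "B s = \<phi> (Var i * (Var j * s))"
    "C s = \<phi> (Var j * (Var j * s))" for s
  note ABC = A_B_C_def
  have minors: "A s * B t = B s * A t" "A s * C t = C s * A t" "B s * C t = C s * B t"
    if "s \<in> forms n e" "t \<in> forms n e" for s t
    using neg contra that unfolding ABC by blast+
  obtain s0 where s0: "s0 \<in> forms n e" "A s0 \<noteq> 0 \<or> B s0 \<noteq> 0 \<or> C s0 \<noteq> 0"
    using spanned_quadric_nonzero[OF \<open>spanned\<close>] unfolding ABC by blast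
  define \<alpha> \<beta> \<gamma> where "\<alpha> = A s0" "\<beta> = B s0" "\<gamma> = C s0"
  note \<alpha>\<beta>\<gamma> = \<alpha>_\<beta>_\<gamma>_def
  have proportional: "\<alpha> * B t = \<beta> * A t" "\<alpha> * C t = \<gamma> * A t" "\<beta> * C t = \<gamma> * B t" if "t \<in> forms n e" for t
    using minors[OF s0(1) that] by (simp_all add: \<alpha>\<beta>\<gamma>)
  have "\<exists>c. A t = c * \<alpha> \<and> B t = c * \<beta> \<and> C t = c * \<gamma>" if t: "t \<in> forms n e" for t
  proof -
    consider "\<alpha> \<noteq> 0" | "\<beta> \<noteq> 0" | "\<gamma> \<noteq> 0" using s0(2) by (auto simp: \<alpha>\<beta>\<gamma>)
    then show ?thesis
    proof cases
      case 1
      then show ?thesis using proportional[OF t] by (intro exI[of _ "A t / \<alpha>"]) (simp add: field_simps)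
    next
      case 2
      then show ?thesis using proportional[OF t] by (intro exI[of _ "B t / \<beta>"]) (simp add: field_simps)
    next
      case 3
      then show ?thesis using proportional[OF t] by (intro exI[of _ "C t / \<gamma>"]) (simp add: field_simps)
    qed
  qed
  then obtain g where g: "A t = g t * \<alpha>" "B t = g t * \<beta>" "C t = g t * \<gamma>" if "t \<in> forms n e" for t
    by metis
  show False
  proof (cases "\<alpha> * \<gamma> = \<beta> * \<beta>")
    case True
    \<comment> \<open>A singular symmetric matrix: each of its rows gives a combination of
      \<open>\<phi>\<^sub>i, \<phi>\<^sub>j\<close> that must be trivial.\<close>
    have eqs: "\<beta> * A t = \<alpha> * B t" "\<beta> * B t = \<alpha> * C t" "\<gamma> * A t = \<beta> * B t" "\<gamma> * B t = \<beta> * C t"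
      if "t \<in> forms n e" for t
    proof -
      have "g t * (\<alpha> * \<gamma>) = g t * (\<beta> * \<beta>)" using True by simp
      then show "\<beta> * A t = \<alpha> * B t" "\<beta> * B t = \<alpha> * C t" "\<gamma> * A t = \<beta> * B t" "\<gamma> * B t = \<beta> * C t"
        by (simp_all only: g[OF that] mult_ac)
    qed
    have "\<beta> = 0 \<and> \<alpha> = 0"
      using spanned_combination_zero[OF \<open>spanned\<close> eqs(1,2)[unfolded ABC]] .
    moreover have "\<gamma> = 0 \<and> \<beta> = 0"
      using spanned_combination_zero[OF \<open>spanned\<close> eqs(3,4)[unfolded ABC]] .
    ultimately show False using s0(2) by (simp add: \<alpha>\<beta>\<gamma>)
  next
    case False
    \<comment> \<open>Shifting a variable, \<open>A (Var j * t) = B (Var i * t)\<close> and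
      \<open>B (Var j * t) = C (Var i * t)\<close>, gives a homogeneous 2 by 2 system for the scalar
      factors at \<open>Var i * t\<close> and \<open>Var j * t\<close>, with invertible
      matrix.\<close>
    have vanish: "A (Var i * t) = 0" "B (Var i * t) = 0" "C (Var i * t) = 0" "C (Var j * t) = 0"
      if t: "t \<in> forms n e'" for t
    proof -
      have ti: "Var i * t \<in> forms n e" and tj: "Var j * t \<in> forms n e"
        using Var_mult_in_forms[OF _ t] ij by (simp_all add: e)
      have "A (Var j * t) = B (Var i * t)" "B (Var j * t) = C (Var i * t)"
        by (simp_all only: ABC mult.left_commute[of "Var j" "Var i"])
      then have "g (Var j * t) * \<alpha> = g (Var i * t) * \<beta>" "g (Var j * t) * \<beta> = g (Var i * t) * \<gamma>"
        unfolding g[OF ti] g[OF tj] .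
      then have "g (Var j * t) * (\<alpha> * \<gamma> - \<beta> * \<beta>) = 0" "g (Var i * t) * (\<alpha> * \<gamma> - \<beta> * \<beta>) = 0"
        by algebra+
      then have "g (Var j * t) = 0" "g (Var i * t) = 0" using False by simp_all
      then show "A (Var i * t) = 0" "B (Var i * t) = 0" "C (Var i * t) = 0" "C (Var j * t) = 0"
        using g[OF ti] g[OF tj] by simp_all
    qed
    have step: "A (Var k * t) = 0 \<and> B (Var k * t) = 0 \<and> C (Var k * t) = 0"
      if k: "k < n" and t: "t \<in> forms n e'" for k t
    proof -
      have in_forms: "Var a * (Var b * t) \<in> forms n (Suc e)" if "a < n" "b < n" for a b
        using that t by (simp add: e Var_mult_in_forms)
      note sp = \<open>spanned\<close>[unfolded spanned_def, rule_format, OF k]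
      have "\<phi> (Var j * (Var i * (Var i * t))) = 0" "\<phi> (Var j * (Var i * (Var j * t))) = 0"
        using vanish(2,3)[OF t] unfolding ABC by (simp_all only: mult.left_commute)
      moreover have "\<phi> (Var i * (Var i * (Var j * t))) = 0" "\<phi> (Var i * (Var j * (Var j * t))) = 0"
        using vanish(2,3)[OF t] unfolding ABC by (simp_all only: mult.left_commute)
      ultimately show ?thesis
        using sp[OF in_forms[OF ij(1) ij(1)]] sp[OF in_forms[OF ij(1) ij(2)]]
          sp[OF in_forms[OF ij(2) ij(2)]] vanish(1,4)[OF t]
        unfolding ABC mult.left_commute[of _ "Var k"] by simp
    qed
    have "functional A" "functional B" "functional C"
      unfolding ABC[abs_def]
      by (rule functional_mult_left[OF functional_mult_left[OF functional_\<phi>]])+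
    then have "A s0 = 0" "B s0 = 0" "C s0 = 0"
      using functional_zero_forms_Suc s0(1) step unfolding e by metis+
    then show False using s0(2) by simp
  qed
qed

text \<open>Bounds the dimension of the space of \<open>hankel\<close> functionals, in dual form:
  few test forms suffice to detect a nonzero one.\<close>

lemma hankel_detecting_set:
  obtains W where "finite W" "W \<subseteq> forms n (Suc (Suc e))" "card W \<le> (if e = 0 then 2 else 1)"
    "\<And>\<psi> p. hankel \<psi> \<Longrightarrow> (\<And>w. w \<in> W \<Longrightarrow> \<psi> w = 0) \<Longrightarrow> p \<in> forms n (Suc (Suc e)) \<Longrightarrow> \<psi> p = 0"
proof -
  have "\<exists>W \<subseteq> {Var i * z1, Var i * z2, Var j * z1}. card W \<le> (if e = 0 then 2 else 1) \<and>
    (\<forall>\<psi>. hankel \<psi> \<longrightarrow> (\<forall>w\<in>W. \<psi> w = 0) \<longrightarrow> (\<forall>p\<in>forms n (Suc (Suc e)). \<psi> p = 0))"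
  proof (cases spanned)
    case False
    then show ?thesis using hankel_zero_if_not_spanned by (intro exI[of _ "{}"]) auto
  next
    case spanned: True
    have suffices: ?thesis
      if W: "W \<subseteq> {Var i * z1, Var i * z2, Var j * z1}" "card W \<le> (if e = 0 then 2 else 1)"
        and zero: "\<And>\<psi>. hankel \<psi> \<Longrightarrow> \<forall>w\<in>W. \<psi> w = 0 \<Longrightarrow>
          \<psi> (Var i * z1) = 0 \<and> \<psi> (Var i * z2) = 0 \<and> \<psi> (Var j * z1) = 0" for W
      using W zero hankel_zero by blast
    show ?thesis
    proof (cases "e = 0")
      \<comment> \<open>One relation with a nonzero coefficient eliminates that parameter;
        \<open>W\<close> consists of the forms for the other two.\<close>
      case True
      obtain s where s: "s \<in> forms n e" and
        "\<phi> (Var i * (Var i * s)) \<noteq> 0 \<or> \<phi> (Var i * (Var j * s)) \<noteq> 0 \<or> \<phi> (Var j * (Var j * s)) \<noteq> 0"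
        using spanned_quadric_nonzero[OF spanned] .
      then consider "\<phi> (Var i * (Var i * s)) \<noteq> 0" | "\<phi> (Var i * (Var j * s)) \<noteq> 0"
        | "\<phi> (Var j * (Var j * s)) \<noteq> 0" by blast
      then show ?thesis
      proof cases
        case 1
        have "\<psi> (Var j * z1) = 0" if "hankel \<psi>" "\<psi> (Var i * z1) = 0" "\<psi> (Var i * z2) = 0" for \<psi>
          using hankel_relation[OF that(1) s] that(2,3) 1 by simp
        then show ?thesis
          using True by (intro suffices[of "{Var i * z1, Var i * z2}"]) (auto simp: card_insert_if)
      next
        case 2
        have "\<psi> (Var i * z1) = 0" if "hankel \<psi>" "\<psi> (Var i * z2) = 0" "\<psi> (Var j * z1) = 0" for \<psi>
          using hankel_relation[OF that(1) s] that(2,3) 2 by simp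
        then show ?thesis
          using True by (intro suffices[of "{Var i * z2, Var j * z1}"]) (auto simp: card_insert_if)
      next
        case 3
        have "\<psi> (Var i * z2) = 0" if "hankel \<psi>" "\<psi> (Var i * z1) = 0" "\<psi> (Var j * z1) = 0" for \<psi>
          using hankel_relation[OF that(1) s] that(2,3) 3 by simp
        then show ?thesis
          using True by (intro suffices[of "{Var i * z1, Var j * z1}"]) (auto simp: card_insert_if)
      qed
    next
      case False
      \<comment> \<open>Two independent relations: the two parameters belonging to the nonzero minor
        are determined by the third, whose form makes up \<open>W\<close>.\<close>
      then obtain e' where e': "e = Suc e'" using not0_implies_Suc by blast
      obtain s t where s: "s \<in> forms n e" and t: "t \<in> forms n e" and
        "\<phi> (Var i * (Var i * s)) * \<phi> (Var i * (Var j * t)) \<noteq> \<phi> (Var i * (Var j * s)) * \<phi> (Var i * (Var i * t)) \<or>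
         \<phi> (Var i * (Var i * s)) * \<phi> (Var j * (Var j * t)) \<noteq> \<phi> (Var j * (Var j * s)) * \<phi> (Var i * (Var i * t)) \<or>
         \<phi> (Var i * (Var j * s)) * \<phi> (Var j * (Var j * t)) \<noteq> \<phi> (Var j * (Var j * s)) * \<phi> (Var i * (Var j * t))"
        using spanned_minor_nonzero[OF spanned e'] .
      then consider
        "\<phi> (Var i * (Var i * s)) * \<phi> (Var i * (Var j * t)) \<noteq> \<phi> (Var i * (Var j * s)) * \<phi> (Var i * (Var i * t))"
        | "\<phi> (Var i * (Var i * s)) * \<phi> (Var j * (Var j * t)) \<noteq> \<phi> (Var j * (Var j * s)) * \<phi> (Var i * (Var i * t))"
        | "\<phi> (Var i * (Var j * s)) * \<phi> (Var j * (Var j * t)) \<noteq> \<phi> (Var j * (Var j * s)) * \<phi> (Var i * (Var j * t))"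
        by blast
      then show ?thesis
      proof cases
        case 1
        have "\<psi> (Var j * z1) = 0 \<and> \<psi> (Var i * z1) = 0" if \<psi>: "hankel \<psi>" "\<psi> (Var i * z2) = 0" for \<psi>
        proof -
          have "\<phi> (Var i * (Var i * s)) * \<psi> (Var j * z1) + \<phi> (Var i * (Var j * s)) * (- 2 * \<psi> (Var i * z1)) = 0"
            if "s \<in> forms n e" for s
            using hankel_relation[OF \<psi>(1) that] \<psi>(2) by algebra
          from linear_system_trivial[OF 1 this[OF s] this[OF t]] show ?thesis by simp
        qed
        then show ?thesis using False by (intro suffices[of "{Var i * z2}"]) auto
      next
        case 2
        have "\<psi> (Var j * z1) = 0 \<and> \<psi> (Var i * z2) = 0" if \<psi>: "hankel \<psi>" "\<psi> (Var i * z1) = 0" for \<psi>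
        proof -
          have "\<phi> (Var i * (Var i * s)) * \<psi> (Var j * z1) + \<phi> (Var j * (Var j * s)) * (- \<psi> (Var i * z2)) = 0"
            if "s \<in> forms n e" for s
            using hankel_relation[OF \<psi>(1) that] \<psi>(2) by algebra
          from linear_system_trivial[OF 2 this[OF s] this[OF t]] show ?thesis by simp
        qed
        then show ?thesis using False by (intro suffices[of "{Var i * z1}"]) auto
      next
        case 3
        have "\<psi> (Var i * z1) = 0 \<and> \<psi> (Var i * z2) = 0" if \<psi>: "hankel \<psi>" "\<psi> (Var j * z1) = 0" for \<psi>
        proof -
          have "\<phi> (Var i * (Var j * s)) * (- 2 * \<psi> (Var i * z1)) + \<phi> (Var j * (Var j * s)) * (- \<psi> (Var i * z2)) = 0"
            if "s \<in> forms n e" for s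
            using hankel_relation[OF \<psi>(1) that] \<psi>(2) by algebra
          from linear_system_trivial[OF 3 this[OF s] this[OF t]] show ?thesis by simp
        qed
        then show ?thesis using False by (intro suffices[of "{Var j * z1}"]) auto
      qed
    qed
  qed
  then obtain W where W: "W \<subseteq> {Var i * z1, Var i * z2, Var j * z1}" "card W \<le> (if e = 0 then 2 else 1)"
    "\<forall>\<psi>. hankel \<psi> \<longrightarrow> (\<forall>w\<in>W. \<psi> w = 0) \<longrightarrow> (\<forall>p\<in>forms n (Suc (Suc e)). \<psi> p = 0)" by blast
  have "finite W" using W(1) by (rule finite_subset) auto
  moreover have "W \<subseteq> forms n (Suc (Suc e))" using W(1) Var_mult_in_forms ij z by blast
  ultimately show ?thesis using that[of W] W by blast
qed

end

subsection \<open>Counting dimensions\<close>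

lemma finite_independent_forms:
  assumes "B \<subseteq> forms n d" "cpoly.independent B"
  shows "finite B"
  using cpoly.independent_span_bound[OF finite_imageI[OF finite_monoms] assms(2)]
    assms(1) forms_finite_dim by blast

lemma hyperplane_functional:
  assumes U: "cpoly.subspace U" "U \<subseteq> forms n d" and codim: "codim_forms n d U = 1"
  obtains f u0 where "functional f" "u0 \<in> forms n d" "f u0 = 1"
    "\<And>p. p \<in> forms n d \<Longrightarrow> p \<in> U \<longleftrightarrow> f p = 0"
proof -
  obtain B where B: "B \<subseteq> U" "cpoly.independent B" "U \<subseteq> cpoly.span B" "card B = cpoly.dim U"
    by (rule cpoly.basis_exists)
  obtain C where C: "C \<subseteq> forms n d" "cpoly.independent C" "forms n d \<subseteq> cpoly.span C"
    "card C = cpoly.dim (forms n d)"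
    by (rule cpoly.basis_exists)
  have finite: "finite B" "finite C"
    using finite_independent_forms[OF order_trans[OF B(1) U(2)] B(2)]
      finite_independent_forms[OF C(1,2)] by this
  have span_B: "cpoly.span B = U"
    using B U by (simp add: cpoly.span_subspace)
  \<comment> \<open>The truncated difference equals \<open>1\<close>, so it is the true
    difference.\<close>
  have card_C: "card C = Suc (card B)"
    using codim B C by (simp add: codim_forms_def)
  have "\<not> C \<subseteq> U"
    using cpoly.independent_span_bound[OF finite(1) C(2)] card_C span_B by auto
  then obtain u0 where u0: "u0 \<in> forms n d" "u0 \<notin> U" using C by blast
  obtain f where f: "functional f" "\<And>p. p \<in> U \<Longrightarrow> f p = 0" "f u0 = 1"
    using separating_functional[of u0 B] u0 span_B by auto
  have "p \<in> U" if p: "p \<in> forms n d" "f p = 0" for p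
  \<comment> \<open>Otherwise \<open>u0\<close> and \<open>p\<close> would both extend
    \<open>B\<close> independently, giving one element more than the dimension of the forms.\<close>
  proof (rule ccontr)
    assume "p \<notin> U"
    let ?D = "insert p (insert u0 B)"
    have "p \<notin> cpoly.span (insert u0 B)"
    proof
      assume "p \<in> cpoly.span (insert u0 B)"
      then obtain c where "p - cpoly_scale c u0 \<in> U"
        using span_B by (auto simp: cpoly.span_insert)
      moreover from this have "c = 0"
        using f(2)[of "p - cpoly_scale c u0"] f p by (simp add: functional_simps[OF f(1)])
      ultimately show False using \<open>p \<notin> U\<close> by simp
    qed
    moreover have "cpoly.independent (insert u0 B)"
      using B(2) u0 span_B by (simp add: cpoly.independent_insert)
    moreover have "u0 \<notin> B" using u0 B by blast
    ultimately have "cpoly.independent ?D" "card ?D = Suc (Suc (card B))"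
      using finite(1) cpoly.span_base[of p "insert u0 B"]
      by (auto simp: cpoly.independent_insert card_insert_if)
    moreover have "?D \<subseteq> cpoly.span C" using p u0 B U C by blast
    ultimately show False
      using cpoly.independent_span_bound[OF finite(2)] card_C by fastforce
  qed
  then show ?thesis using that f u0 by blast
qed

text \<open>By separation, \<open>V \<union> W\<close> spans all forms, so \<open>W\<close> spans
  the quotient by the span of \<open>V\<close>.\<close>

lemma codim_le_card:
  assumes V: "V \<subseteq> forms n d" and W: "finite W"
    and sep: "\<And>f. functional f \<Longrightarrow> (\<And>p. p \<in> V \<union> W \<Longrightarrow> f p = 0) \<Longrightarrow> (\<And>p. p \<in> forms n d \<Longrightarrow> f p = 0)"
  shows "codim_forms n d V \<le> card W"
proof -
  have sub: "forms n d \<subseteq> cpoly.span (V \<union> W)"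
  proof
    fix p assume p: "p \<in> forms n d"
    show "p \<in> cpoly.span (V \<union> W)"
    proof (rule ccontr)
      assume "p \<notin> cpoly.span (V \<union> W)"
      then obtain f where f: "functional f" "\<And>p. p \<in> cpoly.span (V \<union> W) \<Longrightarrow> f p = 0" "f p = 1"
        using separating_functional by metis
      show False using sep[OF f(1) f(2)[OF cpoly.span_base] p] f(3) by simp
    qed
  qed
  obtain B where B: "B \<subseteq> V" "cpoly.independent B" "V \<subseteq> cpoly.span B" "card B = cpoly.dim V"
    by (rule cpoly.basis_exists)
  have "finite B" using finite_independent_forms B V by blast
  have "V \<union> W \<subseteq> cpoly.span (B \<union> W)"
    using B(3) cpoly.span_mono[of B "B \<union> W"] cpoly.span_base[of _ "B \<union> W"] by blast
  then have "forms n d \<subseteq> cpoly.span (B \<union> W)"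
    using sub cpoly.span_minimal[OF _ cpoly.subspace_span] by blast
  then have "cpoly.dim (forms n d) \<le> card (B \<union> W)"
    using cpoly.dim_le_card \<open>finite B\<close> W by blast
  also have "\<dots> \<le> cpoly.dim V + card W" using card_Un_le[of B W] B(4) by simp
  finally show ?thesis by (simp add: codim_forms_def)
qed

section \<open>The codimension of the square\<close>

lemma independent_contractions_exist:
  assumes f: "functional f" and p0: "p0 \<in> forms n (Suc (Suc e))" "f p0 \<noteq> 0"
    and U: "U \<subseteq> forms n (Suc (Suc e))" "\<And>p. p \<in> U \<Longrightarrow> f p = 0" and bpf: "base_point_free n U"
  obtains i j z1 z2 where "independent_contractions n e f i j z1 z2"
proof -
  obtain i j u v where ij: "i < n" "j < n" and uv: "u \<in> forms n (Suc e)" "v \<in> forms n (Suc e)"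
    and ne: "f (Var i * u) * f (Var j * v) \<noteq> f (Var j * u) * f (Var i * v)"
    using nonproportional_contractions[OF f p0 U bpf] .
  define D where "D = f (Var i * u) * f (Var j * v) - f (Var j * u) * f (Var i * v)"
  have "D \<noteq> 0" using ne by (simp add: D_def)
  define comb where "comb a b = cpoly_scale (a / D) u + cpoly_scale (b / D) v" for a b
  have comb: "comb a b \<in> forms n (Suc e)" "f (Var k * comb a b) = (a * f (Var k * u) + b * f (Var k * v)) / D"
    for a b k
    unfolding comb_def
    by (intro cpoly.subspace_add cpoly.subspace_scale subspace_forms uv)
      (simp add: distrib_left cpoly_scale_mult_right functional_simps[OF f] add_divide_distrib)
  \<comment> \<open>The dual pair comes from inverting the matrix of
    \<open>f\<^sub>i, f\<^sub>j\<close> on \<open>u, v\<close>: the coefficients are its cofactors,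
    and \<open>comb\<close> divides by the determinant \<open>D\<close>.\<close>
  have "independent_contractions n e f i j (comb (f (Var j * v)) (- f (Var j * u)))
      (comb (- f (Var i * v)) (f (Var i * u)))"
  proof
    have "f (Var j * v) * f (Var i * u) + - f (Var j * u) * f (Var i * v) = D"
      "- f (Var i * v) * f (Var j * u) + f (Var i * u) * f (Var j * v) = D"
      unfolding D_def by algebra+
    then show "f (Var i * comb (f (Var j * v)) (- f (Var j * u))) = 1"
      "f (Var j * comb (- f (Var i * v)) (f (Var i * u))) = 1"
      unfolding comb(2) using \<open>D \<noteq> 0\<close> by simp_all
    show "f (Var j * comb (f (Var j * v)) (- f (Var j * u))) = 0"
      "f (Var i * comb (- f (Var i * v)) (f (Var i * u))) = 0"
      unfolding comb(2) by simp_all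
  qed (use ij comb(1) functional_simps[OF f] in simp_all)
  then show ?thesis by (rule that)
qed

lemma codim_square_space_le:
  assumes U: "cpoly.subspace U" "U \<subseteq> forms n (Suc (Suc e))" and bpf: "base_point_free n U"
    and codim: "codim_forms n (Suc (Suc e)) U = 1"
  shows "codim_forms n (2 * Suc (Suc e)) (square_space U) \<le> (if e = 0 then 2 else 1)"
proof -
  let ?d = "Suc (Suc e)"
  obtain \<phi> u0 where \<phi>: "functional \<phi>" "\<And>p. p \<in> forms n ?d \<Longrightarrow> p \<in> U \<longleftrightarrow> \<phi> p = 0"
    and u0: "u0 \<in> forms n ?d" "\<phi> u0 = 1"
    using hyperplane_functional[OF U codim] by metis
  have "\<phi> u0 \<noteq> 0" "\<And>p. p \<in> U \<Longrightarrow> \<phi> p = 0"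
    using \<phi>(2) U(2) u0(2) by auto
  from independent_contractions_exist[OF \<phi>(1) u0(1) this(1) U(2) this(2) bpf]
  obtain i j z1 z2 where "independent_contractions n e \<phi> i j z1 z2" .
  then interpret independent_contractions n e \<phi> i j z1 z2 .
  obtain W where W: "finite W" "W \<subseteq> forms n ?d" "card W \<le> (if e = 0 then 2 else 1)"
    "\<And>\<psi> p. hankel \<psi> \<Longrightarrow> (\<And>w. w \<in> W \<Longrightarrow> \<psi> w = 0) \<Longrightarrow> p \<in> forms n ?d \<Longrightarrow> \<psi> p = 0"
    using hankel_detecting_set by metis
  \<comment> \<open>Setting \<open>p = u0\<close> in
    \<open>L (p q) = \<phi> p \<psi> q + \<psi> p \<phi> q\<close> forces
    \<open>\<psi> u0 = L (u0 * u0) / 2\<close> and hence \<open>\<psi> q = L (lift q)\<close>. So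
    testing \<open>\<psi>\<close> on \<open>W\<close> is testing \<open>L\<close> on
    \<open>lift\<close> applied to \<open>W\<close>.\<close>
  define lift where "lift q = u0 * q - cpoly_scale (\<phi> q / 2) (u0 * u0)" for q
  have "codim_forms n (2 * ?d) (square_space U) \<le> card (lift ` W)"
  proof (rule codim_le_card)
    show "square_space U \<subseteq> forms n (2 * ?d)" by (rule square_space_subset_forms) fact
    show "finite (lift ` W)" using W(1) by simp
    fix L p assume L: "functional L" and zero: "\<And>p. p \<in> square_space U \<union> lift ` W \<Longrightarrow> L p = 0"
      and p: "p \<in> forms n (2 * ?d)"
    note L_simps = functional_simps[OF L]
    define \<psi> where "\<psi> q = L (lift q)" for q
    define h where "h = L (u0 * u0) / 2"
    have L_u0: "L (u0 * u0) = 2 * h" by (simp add: h_def)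
    have \<psi>_eq: "\<psi> q = L (u0 * q) - \<phi> q * h" for q
      by (simp add: \<psi>_def lift_def L_simps L_u0)
    have symmetrize: "a * y + b * (w - a * (2 * h)) = a * (y - b * h) + (w - a * h) * b"
      for a b h w y :: complex by algebra
    have L_eq: "L (p * q) = \<phi> p * \<psi> q + \<psi> p * \<phi> q"
      if p: "p \<in> forms n ?d" and q: "q \<in> forms n ?d" for p q
    proof -
      \<comment> \<open>Both factors are projected to \<open>U\<close> along \<open>u0\<close>;
        expanding their product, on which \<open>L\<close> vanishes, gives the formula.\<close>
      have in_U: "p - cpoly_scale (\<phi> p) u0 \<in> U" if "p \<in> forms n ?d" for p
        using that u0 \<phi>(2)[of "p - cpoly_scale (\<phi> p) u0"]
        by (simp add: \<phi>_simps cpoly.subspace_diff cpoly.subspace_scale subspace_forms)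
      have "(p - cpoly_scale (\<phi> p) u0) * (q - cpoly_scale (\<phi> q) u0) \<in> square_space U"
        unfolding square_space_def using in_U[OF p] in_U[OF q] by (intro cpoly.span_base) blast
      then have "L ((p - cpoly_scale (\<phi> p) u0) * (q - cpoly_scale (\<phi> q) u0)) = 0"
        using zero by blast
      then have "L (p * q) - \<phi> p * L (u0 * q) - \<phi> q * (L (u0 * p) - \<phi> p * L (u0 * u0)) = 0"
        by (simp only: left_diff_distrib right_diff_distrib cpoly_scale_mult_left
            cpoly_scale_mult_right L_simps mult.commute[of p u0])
      then have "L (p * q) = \<phi> p * L (u0 * q) + \<phi> q * (L (u0 * p) - \<phi> p * L (u0 * u0))"
        by (simp only: diff_diff_eq right_minus_eq)
      then show ?thesis unfolding \<psi>_eq L_u0 symmetrize .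
    qed
    have "\<psi> = (\<lambda>q. 1 * L (u0 * q) - h * \<phi> q)"
      by (rule ext) (simp add: \<psi>_eq)
    then have "functional \<psi>"
      by (simp only: functional_combination functional_mult_left L \<phi>(1))
    moreover have "\<phi> (Var k * u) * \<psi> (Var l * v) + \<psi> (Var k * u) * \<phi> (Var l * v) =
       \<phi> (Var l * u) * \<psi> (Var k * v) + \<psi> (Var l * u) * \<phi> (Var k * v)"
      if "k < n" "l < n" "u \<in> forms n (Suc e)" "v \<in> forms n (Suc e)" for k l u v
    proof -
      \<comment> \<open>Two factorizations of one form, to which \<open>L_eq\<close> is applied
        separately.\<close>
      have "Var k * u * (Var l * v) = Var l * u * (Var k * v)"
        by (simp only: mult_ac)
      then show ?thesis
        using L_eq[OF Var_mult_in_forms[OF that(1,3)] Var_mult_in_forms[OF that(2,4)]]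
          L_eq[OF Var_mult_in_forms[OF that(2,3)] Var_mult_in_forms[OF that(1,4)]] by metis
    qed
    ultimately have "hankel \<psi>" by (simp add: hankel_def)
    moreover have "\<psi> w = 0" if "w \<in> W" for w
      using zero that by (simp add: \<psi>_def)
    ultimately have "\<psi> q = 0" if "q \<in> forms n ?d" for q
      using W(4) that by blast
    then show "L p = 0"
      using functional_zero_forms_add[OF L, of n ?d ?d p] L_eq p by (simp add: mult_2)
  qed
  also have "card (lift ` W) \<le> card W" using W(1) by (rule card_image_le)
  finally show ?thesis using W(3) by linarith
qed

theorem proposition5p3:
  fixes n d :: nat and U :: "cpoly set"
  assumes "n \<ge> 2" and "d \<ge> 2"
    and "cpoly.subspace U" and "U \<subseteq> forms n d"
    and "base_point_free n U"
    and "codim_forms n d U = 1"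
  shows "(d \<ge> 3 \<longrightarrow> codim_forms n (2 * d) (square_space U) \<in> {0, 1}) \<and>
         (d = 2 \<longrightarrow> codim_forms n (2 * d) (square_space U) \<le> 2)"
proof -
  obtain e where d: "d = Suc (Suc e)"
    using \<open>d \<ge> 2\<close> by (auto simp: numeral_2_eq_2 Suc_le_eq dest!: less_imp_Suc_add)
  have "codim_forms n (2 * d) (square_space U) \<le> (if e = 0 then 2 else 1)"
    unfolding d by (rule codim_square_space_le) (use assms(3-6) d in simp_all)
  moreover have "e = 0 \<longleftrightarrow> d = 2" using d by simp
  ultimately show ?thesis by (auto split: if_splits)
qed

end
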